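(* Let $\mu\colon\mathcal{B}_{\mathbb{D}}\to[0,+\infty)$ be a finite Borel measure on $\mathbb{D}$. Then the following conditions are equivalent: (a) $\mu$ is radial; (b) there exists a finite Borel measure $\eta\colon\mathcal{B}_{[0,1)}\to[0,+\infty)$ such that $\mu$ is the radial extension of $\eta$, i.e., $\mu=\nu_\eta$.
   Context: $\mathbb{D}$ is the open unit disk in $\mathbb{C}$ and $\mathbb{T}=\{z\in\mathbb{C}\colon |z|=1\}$. For a topological space $T$, $\mathcal{B}_T$ denotes the $\sigma$-algebra of Borel subsets of $T$. A Borel measure $\mu$ on $\mathbb{D}$ is called radial if $\mu(\tau Z)=\mu(Z)$ for every $\tau\in\mathbb{T}$ and every $Z\in\mathcal{B}_{\mathbb{D}}$. Let $\lambda_{\mathbb{T}}$ be the Haar (arc length) measure on $\mathbb{T}$ normalized by $\lambda_{\mathbb{T}}(\mathbb{T})=2\pi$. Let $\Theta\colon[0,1)\times\mathbb{T}\to\mathbb{D}$, $\Theta(r,\tau)=r\tau$. For a Borel measure $\eta$ on $[0,1)$ the radial extension $\nu_\eta$ of $\eta$ is the Borel measure on $\mathbb{D}$ defined as the pushforward $\nu_\eta(Z)=(\eta\times\lambda_{\mathbb{T}})(\Theta^{-1}(Z))$ for $Z\in\mathcal{B}_{\mathbb{D}}$. *)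

theory Defs
  imports "HOL-Analysis.Analysis"
begin

definition borel_measure_on :: "'a::topological_space set \<Rightarrow> 'a measure \<Rightarrow> bool" where
  "borel_measure_on S M \<longleftrightarrow> sets M = sets (restrict_space borel S)"

definition radial :: "complex measure \<Rightarrow> bool" where
  "radial \<mu> \<longleftrightarrow>
     (\<forall>\<tau>\<in>sphere 0 1. \<forall>Z\<in>sets (restrict_space borel (ball 0 1)).
        emeasure \<mu> ((\<lambda>z. \<tau> * z) ` Z) = emeasure \<mu> Z)"

text \<open>
  Arc length on the unit circle, obtained from the unit-speed parametrisation
  \<open>cis\<close> on \<open>[0, 2\<pi>)\<close>. That it is the Haar measure of total mass \<open>2\<pi>\<close> is the content
  of \<open>emeasure_circle_measure_total\<close> and \<open>emeasure_circle_measure_rotate\<close> below.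
\<close>

definition circle_measure :: "complex measure" where
  "circle_measure =
     distr (restrict_space lborel {0..<2 * pi}) (restrict_space borel (sphere 0 1)) cis"

definition polar_map :: "real \<times> complex \<Rightarrow> complex" where
  "polar_map = (\<lambda>(r, \<tau>). of_real r * \<tau>)"

definition radial_extension :: "real measure \<Rightarrow> complex measure" where
  "radial_extension \<eta> =
     distr (\<eta> \<Otimes>\<^sub>M circle_measure) (restrict_space borel (ball 0 1)) polar_map"

lemma borel_measure_on_circle_measure: "borel_measure_on (sphere 0 1) circle_measure"
  by (simp add: borel_measure_on_def circle_measure_def)

lemma space_circle_measure [simp]: "space circle_measure = sphere 0 1"
  by (simp add: circle_measure_def space_restrict_space)

lemma measurable_cis_circle:
  "cis \<in> restrict_space lborel A \<rightarrow>\<^sub>M restrict_space borel (sphere 0 1)"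
proof (rule measurable_restrict_space2)
  have "cis \<in> borel_measurable borel"
    by (intro borel_measurable_continuous_onI continuous_intros)
  then show "cis \<in> restrict_space lborel A \<rightarrow>\<^sub>M borel"
    by (intro measurable_restrict_space1) simp
qed simp

lemma emeasure_circle_measure:
  assumes "Z \<in> sets (restrict_space borel (sphere 0 1))"
  shows "emeasure circle_measure Z = emeasure lborel {t\<in>{0..<2 * pi}. cis t \<in> Z}"
proof -
  have "emeasure circle_measure Z =
      emeasure (restrict_space lborel {0..<2 * pi}) (cis -` Z \<inter> {0..<2 * pi})"
    using assms measurable_cis_circle unfolding circle_measure_def
    by (subst emeasure_distr) (auto simp: space_restrict_space)
  also have "\<dots> = emeasure lborel (cis -` Z \<inter> {0..<2 * pi})"
    by (rule emeasure_restrict_space) auto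
  also have "cis -` Z \<inter> {0..<2 * pi} = {t\<in>{0..<2 * pi}. cis t \<in> Z}"
    by auto
  finally show ?thesis .
qed

lemma emeasure_circle_measure_total: "emeasure circle_measure (sphere 0 1) = ennreal (2 * pi)"
proof -
  have "sphere 0 1 \<in> sets (restrict_space borel (sphere (0::complex) 1))"
    by (auto simp: sets_restrict_space_iff)
  moreover have "{t\<in>{0..<2 * pi}. cis t \<in> sphere 0 1} = {0..<2 * pi}"
    by auto
  ultimately show ?thesis
    by (simp add: emeasure_circle_measure)
qed

lemma emeasure_lborel_shift:
  fixes A :: "real set"
  assumes "A \<in> sets borel"
  shows "emeasure lborel {t. t - c \<in> A} = emeasure lborel A"
proof -
  have "emeasure lborel A = emeasure (distr lborel borel ((+) (- c))) A"
    by (simp only: lborel_distr_plus)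
  also have "\<dots> = emeasure lborel {t. t - c \<in> A}"
    using assms by (subst emeasure_distr) (auto intro!: arg_cong[where f = "emeasure lborel"])
  finally show ?thesis by simp
qed

lemma emeasure_circle_measure_rotate:
  assumes \<tau>: "\<tau> \<in> sphere 0 1" and Z: "Z \<in> sets (restrict_space borel (sphere 0 1))"
  shows "emeasure circle_measure ((\<lambda>z. \<tau> * z) ` Z) = emeasure circle_measure Z"
proof -
  have \<tau>0: "\<tau> \<noteq> 0" and n1: "norm \<tau> = 1" using \<tau> by auto
  obtain a where a: "0 \<le> a" "a < 2 * pi" "\<tau> = cis a"
  proof -
    have "\<tau> = cis (Arg2pi \<tau>)"
      using Arg2pi_eq[of \<tau>] n1 by (simp add: cis_conv_exp mult.commute)
    then show ?thesis using that[of "Arg2pi \<tau>"] Arg2pi_ge_0 Arg2pi_lt_2pi by blast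
  qed
  define A where "A = {t. cis t \<in> Z}"
  have Zb: "Z \<in> sets borel" "Z \<subseteq> sphere 0 1"
    using Z by (auto simp: sets_restrict_space_iff)
  have cisb: "cis \<in> borel_measurable borel"
    by (intro borel_measurable_continuous_onI continuous_intros)
  have A[measurable]: "A \<in> sets borel"
    using measurable_sets[OF cisb Zb(1)] by (simp add: A_def vimage_def)
  have img: "(\<lambda>z. \<tau> * z) ` Z = (\<lambda>z. z / \<tau>) -` Z"
    using \<tau>0 by (force simp: image_iff)
  have "(\<lambda>z. z / \<tau>) \<in> borel_measurable borel" by simp
  from measurable_sets[OF this Zb(1)] have "(\<lambda>z. \<tau> * z) ` Z \<in> sets borel"
    by (simp add: img)
  moreover have "(\<lambda>z. \<tau> * z) ` Z \<subseteq> sphere 0 1"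
    using Zb(2) n1 by (auto simp: norm_mult)
  ultimately have rot: "(\<lambda>z. \<tau> * z) ` Z \<in> sets (restrict_space borel (sphere 0 1))"
    by (auto simp: sets_restrict_space_iff)
  have shift: "cis t \<in> (\<lambda>z. \<tau> * z) ` Z \<longleftrightarrow> t - a \<in> A" for t
    unfolding img by (simp add: A_def a(3) cis_divide)
  have per: "t + 2 * pi \<in> A \<longleftrightarrow> t \<in> A" for t
    by (simp add: A_def flip: cis_mult)
  have 1: "{t. t - a \<in> A \<inter> {0..<2 * pi - a}} = {t\<in>{a..<2 * pi}. t - a \<in> A}"
    by auto
  have 2: "{t. t - (a - 2 * pi) \<in> A \<inter> {2 * pi - a..<2 * pi}} = {t\<in>{0..<a}. t - a \<in> A}"
    using per[of "t - a" for t] by (auto simp: algebra_simps)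
  have AI[measurable]: "A \<inter> {0..<2 * pi - a} \<in> sets borel" "A \<inter> {2 * pi - a..<2 * pi} \<in> sets borel"
    by auto
  have B: "{t\<in>S. t - a \<in> A} \<in> sets borel" if "S \<in> sets borel" for S
  proof -
    have "(\<lambda>t. t - a) -` A \<in> sets borel"
      using measurable_sets[of "\<lambda>t. t - a" borel borel A] A by simp
    moreover have "{t\<in>S. t - a \<in> A} = S \<inter> (\<lambda>t. t - a) -` A" by auto
    ultimately show ?thesis using that by auto
  qed
  have "emeasure circle_measure ((\<lambda>z. \<tau> * z) ` Z) =
      emeasure lborel {t\<in>{0..<2 * pi}. t - a \<in> A}"
    by (simp add: emeasure_circle_measure[OF rot] shift)
  also have "{t\<in>{0..<2 * pi}. t - a \<in> A} =
      {t\<in>{a..<2 * pi}. t - a \<in> A} \<union> {t\<in>{0..<a}. t - a \<in> A}"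
    using a by auto
  also have "emeasure lborel \<dots> =
      emeasure lborel {t\<in>{a..<2 * pi}. t - a \<in> A} + emeasure lborel {t\<in>{0..<a}. t - a \<in> A}"
    using B by (intro plus_emeasure[symmetric]) auto
  also have "\<dots> = emeasure lborel (A \<inter> {0..<2 * pi - a}) + emeasure lborel (A \<inter> {2 * pi - a..<2 * pi})"
    using emeasure_lborel_shift[OF AI(1), of a] emeasure_lborel_shift[OF AI(2), of "a - 2 * pi"]
    unfolding 1 2 by simp
  also have "\<dots> = emeasure lborel (A \<inter> {0..<2 * pi - a} \<union> A \<inter> {2 * pi - a..<2 * pi})"
    using AI by (intro plus_emeasure) auto
  also have "A \<inter> {0..<2 * pi - a} \<union> A \<inter> {2 * pi - a..<2 * pi} = {t\<in>{0..<2 * pi}. cis t \<in> Z}"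
    using a by (auto simp: A_def)
  also have "emeasure lborel \<dots> = emeasure circle_measure Z"
    by (simp add: emeasure_circle_measure[OF Z])
  finally show ?thesis .
qed

lemma measurable_polar_map:
  assumes "borel_measure_on {0..<1} \<eta>"
  shows "polar_map \<in> \<eta> \<Otimes>\<^sub>M circle_measure \<rightarrow>\<^sub>M restrict_space borel (ball 0 1)"
proof (rule measurable_restrict_space2)
  have sets\<eta>: "sets \<eta> = sets (restrict_space borel {0..<1})"
    using assms by (simp add: borel_measure_on_def)
  have sp: "space \<eta> = {0..<1}"
    using sets_eq_imp_space_eq[OF sets\<eta>] by (simp add: space_restrict_space)
  show "polar_map \<in> space (\<eta> \<Otimes>\<^sub>M circle_measure) \<rightarrow> ball 0 1"
    by (auto simp: space_pair_measure sp polar_map_def norm_mult)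
  have "(\<lambda>r. r) \<in> borel_measurable \<eta>"
    unfolding measurable_cong_sets[OF sets\<eta> refl] by (intro measurable_restrict_space1) simp
  moreover have "(\<lambda>z. z) \<in> borel_measurable circle_measure"
    unfolding measurable_cong_sets[OF borel_measure_on_circle_measure[unfolded borel_measure_on_def] refl]
    by (intro measurable_restrict_space1) simp
  ultimately have [measurable]: "fst \<in> borel_measurable (\<eta> \<Otimes>\<^sub>M circle_measure)"
      "snd \<in> borel_measurable (\<eta> \<Otimes>\<^sub>M circle_measure)"
    using measurable_compose[OF measurable_fst] measurable_compose[OF measurable_snd] by blast+
  show "polar_map \<in> borel_measurable (\<eta> \<Otimes>\<^sub>M circle_measure)"
    unfolding polar_map_def split_beta by measurable
qed

lemma emeasure_radial_extension:
  assumes "borel_measure_on {0..<1} \<eta>" "Z \<in> sets (restrict_space borel (ball 0 1))"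
  shows "emeasure (radial_extension \<eta>) Z =
    emeasure (\<eta> \<Otimes>\<^sub>M circle_measure) (polar_map -` Z \<inter> space (\<eta> \<Otimes>\<^sub>M circle_measure))"
  unfolding radial_extension_def
  by (rule emeasure_distr[OF measurable_polar_map[OF assms(1)] assms(2)])

end

(* For radial \<mu>, averaging \<mu>(\<tau>^-1 Z) = \<mu>(Z) over the circle and exchanging the integrals gives
   2 pi \<mu>(Z) = \<integral> c(z) d\<mu>(z), where c(z) is the arc length of {\<tau>. z \<tau> \<in> Z}. By rotation invariance
   c(z) = c(|z|), so the image of \<mu> / (2 pi) under the norm is the required radial part. *)

theory Submission
  imports Defs
begin

lemma finite_measure_circle_measure: "finite_measure circle_measure"
  by (rule finite_measureI) (simp add: emeasure_circle_measure_total)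

lemma space_borel_measure_on: "borel_measure_on S M \<Longrightarrow> space M = S"
  unfolding borel_measure_on_def by (drule sets_eq_imp_space_eq) (simp add: space_restrict_space)

lemma borel_measure_on_ident_measurable:
  assumes "borel_measure_on S M"
  shows "(\<lambda>x. x) \<in> borel_measurable M"
  unfolding measurable_cong_sets[OF assms[unfolded borel_measure_on_def] refl]
  by (intro measurable_restrict_space1) simp

lemma sets_mult_circle:
  fixes w :: complex
  assumes "Z \<in> sets borel"
  shows "{s \<in> sphere 0 1. w * s \<in> Z} \<in> sets (restrict_space borel (sphere 0 1))"
proof -
  have "(\<lambda>s. w * s) -` Z \<in> sets borel"
    using measurable_sets[of "\<lambda>s. w * s" borel borel Z] assms by simp
  moreover have "{s \<in> sphere 0 1. w * s \<in> Z} = (\<lambda>s. w * s) -` Z \<inter> sphere 0 1"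
    by auto
  ultimately show ?thesis
    by (auto simp: sets_restrict_space_iff)
qed

text \<open>Multiplication by a unit is invertible, so a rotated set is a preimage under the inverse
  rotation. In this form measurability and membership can be read off directly.\<close>

lemma mult_unit_image:
  fixes \<tau> :: complex
  assumes "norm \<tau> = 1"
  shows "(\<lambda>z. \<tau> * z) ` Z = {z. inverse \<tau> * z \<in> Z}"
proof -
  have "\<tau> \<noteq> 0" using assms by auto
  then show ?thesis
    by (force simp: image_iff field_simps)
qed

text \<open>The substitution \<open>s\<close> to \<open>\<tau> * s\<close> carries the first set of
  angles onto the second, so the rotation invariance of arc length applies.\<close>

lemma emeasure_circle_mult_unit:
  assumes \<tau>: "norm \<tau> = 1" and Z: "Z \<in> sets borel"
  shows "emeasure circle_measure {s \<in> sphere 0 1. \<tau> * w * s \<in> Z} =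
    emeasure circle_measure {s \<in> sphere 0 1. w * s \<in> Z}"
proof -
  have \<tau>0: "\<tau> \<noteq> 0" using \<tau> by auto
  have "(\<lambda>s. \<tau> * s) ` {s \<in> sphere 0 1. \<tau> * w * s \<in> Z} = {s \<in> sphere 0 1. w * s \<in> Z}"
    unfolding mult_unit_image[OF \<tau>] using \<tau> \<tau>0
    by (auto simp: norm_mult norm_divide field_simps)
  then show ?thesis
    using emeasure_circle_measure_rotate[of \<tau>, OF _ sets_mult_circle[OF Z, of "\<tau> * w"]] \<tau> by simp
qed

lemma emeasure_circle_mult_norm:
  assumes "Z \<in> sets borel"
  shows "emeasure circle_measure {s \<in> sphere 0 1. of_real (norm w) * s \<in> Z} =
    emeasure circle_measure {s \<in> sphere 0 1. w * s \<in> Z}"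
proof (cases "w = 0")
  case False
  \<comment> \<open>Polar decomposition: \<open>sgn w\<close> is the unit factor by which
    \<open>w\<close> differs from its modulus. At \<open>w = 0\<close> the two sets
    coincide.\<close>
  have "sgn w * of_real (norm w) = w"
    using False by (simp add: sgn_div_norm scaleR_conv_of_real)
  then show ?thesis
    using emeasure_circle_mult_unit[OF _ assms, of "sgn w" "of_real (norm w)"] False
    by (simp add: norm_sgn)
qed simp

text \<open>The general \<open>f\<close> serves two cases: the embedding \<open>of_real\<close> of a
  radius, and the identity on the disk for \<mu> itself.\<close>

lemma sets_pair_circle_mult:
  assumes [measurable]: "f \<in> borel_measurable M" "Z \<in> sets borel"
  shows "{p \<in> space M \<times> sphere 0 1. f (fst p) * snd p \<in> Z} \<in> sets (M \<Otimes>\<^sub>M circle_measure)"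
proof -
  note borel_measure_on_ident_measurable[OF borel_measure_on_circle_measure]
  then have [measurable]: "snd \<in> borel_measurable (M \<Otimes>\<^sub>M circle_measure)"
    using measurable_compose[OF measurable_snd] by blast
  have "{p \<in> space (M \<Otimes>\<^sub>M circle_measure). f (fst p) * snd p \<in> Z} \<in> sets (M \<Otimes>\<^sub>M circle_measure)"
    by measurable
  then show ?thesis
    by (simp add: space_pair_measure)
qed

lemma measurable_emeasure_circle_mult:
  assumes "f \<in> borel_measurable M" "Z \<in> sets borel"
  shows "(\<lambda>x. emeasure circle_measure {s \<in> sphere 0 1. f x * s \<in> Z}) \<in> borel_measurable M"
proof -
  interpret C: finite_measure circle_measure by (rule finite_measure_circle_measure)
  show ?thesis
    \<comment> \<open>For \<open>x\<close> in \<open>space M\<close>, the section at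
      \<open>x\<close> of the product set is exactly the set of \<open>s\<close> in
      question.\<close>
    using C.measurable_emeasure_Pair[OF sets_pair_circle_mult[OF assms]]
    by (rule measurable_cong[THEN iffD1, rotated]) (auto intro!: arg_cong[where f="emeasure _"])
qed

lemma emeasure_pair_circle_mult:
  assumes "f \<in> borel_measurable M" "Z \<in> sets borel"
  shows "emeasure (M \<Otimes>\<^sub>M circle_measure) {p \<in> space M \<times> sphere 0 1. f (fst p) * snd p \<in> Z} =
    (\<integral>\<^sup>+x. emeasure circle_measure {s \<in> sphere 0 1. f x * s \<in> Z} \<partial>M)"
proof -
  interpret C: finite_measure circle_measure by (rule finite_measure_circle_measure)
  show ?thesis
    unfolding C.emeasure_pair_measure_alt[OF sets_pair_circle_mult[OF assms]]
    by (intro nn_integral_cong) (auto intro!: arg_cong[where f="emeasure _"])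
qed

text \<open>The preimage of \<open>Z\<close> under \<open>polar_map\<close> is the product set above
  with \<open>f = of_real\<close>; cutting it at fixed radius gives the integral. Both directions of
  the theorem access the radial extension through this formula.\<close>

lemma emeasure_radial_extension_integral:
  assumes \<eta>: "borel_measure_on {0..<1} \<eta>" and Z: "Z \<in> sets (restrict_space borel (ball 0 1))"
  shows "emeasure (radial_extension \<eta>) Z =
    (\<integral>\<^sup>+r. emeasure circle_measure {s \<in> sphere 0 1. of_real r * s \<in> Z} \<partial>\<eta>)"
proof -
  have Zb: "Z \<in> sets borel" using Z by (auto simp: sets_restrict_space_iff)
  note borel_measure_on_ident_measurable[OF \<eta>, measurable]
  have m: "(of_real :: real \<Rightarrow> complex) \<in> borel_measurable \<eta>" by measurable
  have "polar_map -` Z \<inter> space (\<eta> \<Otimes>\<^sub>M circle_measure) =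
      {p \<in> space \<eta> \<times> sphere 0 1. of_real (fst p) * snd p \<in> Z}"
    by (auto simp: space_pair_measure polar_map_def)
  then show ?thesis
    by (simp add: emeasure_radial_extension[OF \<eta> Z] emeasure_pair_circle_mult[OF m Zb])
qed

lemma rotate_sets_ball:
  assumes \<tau>: "norm \<tau> = 1" and Z: "Z \<in> sets (restrict_space borel (ball (0::complex) 1))"
  shows "(\<lambda>z. \<tau> * z) ` Z \<in> sets (restrict_space borel (ball 0 1))"
proof -
  have Zb: "Z \<in> sets borel" "Z \<subseteq> ball 0 1"
    using Z by (auto simp: sets_restrict_space_iff)
  have "(\<lambda>z. inverse \<tau> * z) -` Z \<in> sets borel"
    using measurable_sets[of "\<lambda>z. inverse \<tau> * z" borel borel Z] Zb by simp
  then have "(\<lambda>z. \<tau> * z) ` Z \<in> sets borel"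
    unfolding mult_unit_image[OF \<tau>] by (simp add: vimage_def)
  moreover have "(\<lambda>z. \<tau> * z) ` Z \<subseteq> ball 0 1"
    using Zb \<tau> by (auto simp: norm_mult)
  ultimately show ?thesis
    by (auto simp: sets_restrict_space_iff)
qed

text \<open>Rotating \<open>Z\<close> only inserts the unit \<open>inverse \<tau>\<close> into the
  integrand, and arc length ignores it, so the two integrands agree at every radius.\<close>

lemma radial_radial_extension:
  assumes \<eta>: "borel_measure_on {0..<1} \<eta>"
  shows "radial (radial_extension \<eta>)"
  unfolding radial_def
proof (intro ballI)
  fix \<tau> :: complex and Z :: "complex set"
  assume "\<tau> \<in> sphere 0 1" and Z: "Z \<in> sets (restrict_space borel (ball 0 1))"
  then have \<tau>: "norm \<tau> = 1" "norm (inverse \<tau>) = 1" by (auto simp: norm_inverse)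
  have Zb: "Z \<in> sets borel" using Z by (auto simp: sets_restrict_space_iff)
  show "emeasure (radial_extension \<eta>) ((\<lambda>z. \<tau> * z) ` Z) = emeasure (radial_extension \<eta>) Z"
    unfolding emeasure_radial_extension_integral[OF \<eta> Z]
      emeasure_radial_extension_integral[OF \<eta> rotate_sets_ball[OF \<tau>(1) Z]]
    using emeasure_circle_mult_unit[OF \<tau>(2) Zb]
    by (simp add: mult_unit_image[OF \<tau>(1)] mult.assoc)
qed

text \<open>Tonelli on the set of pairs \<open>(z, s)\<close> with \<open>z * s\<close> in
  \<open>Z\<close>: sections at fixed \<open>z\<close> give the left side, while sections at fixed
  \<open>s\<close> are rotated copies of \<open>Z\<close>, all of measure
  \<open>emeasure \<mu> Z\<close> by radiality. Integrating this constant over the circle yields the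
  factor \<open>2 * pi\<close>.\<close>

lemma radial_average:
  assumes \<mu>: "borel_measure_on (ball 0 1) \<mu>" and fin: "finite_measure \<mu>" and rad: "radial \<mu>"
    and Z: "Z \<in> sets (restrict_space borel (ball 0 1))"
  shows "(\<integral>\<^sup>+z. emeasure circle_measure {s \<in> sphere 0 1. z * s \<in> Z} \<partial>\<mu>) =
    ennreal (2 * pi) * emeasure \<mu> Z"
proof -
  interpret M: finite_measure \<mu> by (rule fin)
  interpret C: finite_measure circle_measure by (rule finite_measure_circle_measure)
  interpret pair_sigma_finite \<mu> circle_measure ..
  have Zb: "Z \<in> sets borel" "Z \<subseteq> ball 0 1"
    using Z by (auto simp: sets_restrict_space_iff)
  have sp: "space \<mu> = ball 0 1" by (rule space_borel_measure_on[OF \<mu>])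
  note id = borel_measure_on_ident_measurable[OF \<mu>]
  have inner: "(\<lambda>z. (z, s)) -` {p \<in> space \<mu> \<times> sphere 0 1. fst p * snd p \<in> Z} =
      (\<lambda>z. inverse s * z) ` Z" if "s \<in> sphere 0 1" for s
  proof -
    have s: "norm s = 1" "norm (inverse s) = 1" using that by (auto simp: norm_inverse)
    \<comment> \<open>The section only contains points of \<open>space \<mu>\<close>. Since
      \<open>s\<close> is a unit and \<open>Z\<close> lies in the disk, the whole rotated set does
      too, so nothing is cut off.\<close>
    have "norm z < 1" if "s * z \<in> Z" for z
      using subsetD[OF Zb(2) that] s by (simp add: norm_mult)
    then show ?thesis
      unfolding mult_unit_image[OF s(2)] using s by (auto simp: sp mult.commute)
  qed
  have "(\<integral>\<^sup>+z. emeasure circle_measure {s \<in> sphere 0 1. z * s \<in> Z} \<partial>\<mu>) =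
      (\<integral>\<^sup>+s. emeasure \<mu> ((\<lambda>z. (z, s)) -` {p \<in> space \<mu> \<times> sphere 0 1. fst p * snd p \<in> Z})
        \<partial>circle_measure)"
    unfolding emeasure_pair_circle_mult[OF id Zb(1), symmetric]
    by (rule emeasure_pair_measure_alt2[OF sets_pair_circle_mult[OF id Zb(1)]])
  also have "\<dots> = (\<integral>\<^sup>+s. emeasure \<mu> Z \<partial>circle_measure)"
  proof (intro nn_integral_cong)
    fix s assume "s \<in> space circle_measure"
    then have "s \<in> sphere 0 1" "inverse s \<in> sphere 0 1" by (auto simp: norm_inverse)
    then show "emeasure \<mu> ((\<lambda>z. (z, s)) -` {p \<in> space \<mu> \<times> sphere 0 1. fst p * snd p \<in> Z}) =
        emeasure \<mu> Z"
      using rad Z unfolding radial_def by (subst inner) blast+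
  qed
  also have "\<dots> = ennreal (2 * pi) * emeasure \<mu> Z"
    by (simp add: emeasure_circle_measure_total mult.commute)
  finally show ?thesis .
qed

text \<open>The factor \<open>1 / (2 * pi)\<close> compensates for the total arc length, by which
  the product with \<open>circle_measure\<close> multiplies the mass.\<close>

definition radial_part :: "complex measure \<Rightarrow> real measure" where
  "radial_part \<mu> =
     scale_measure (ennreal (1 / (2 * pi))) (distr \<mu> (restrict_space borel {0..<1}) norm)"

lemma borel_measure_on_radial_part: "borel_measure_on {0..<1} (radial_part \<mu>)"
  by (simp add: borel_measure_on_def radial_part_def)

lemma measurable_norm_ball:
  assumes "borel_measure_on (ball 0 1) \<mu>"
  shows "norm \<in> \<mu> \<rightarrow>\<^sub>M restrict_space borel {0..<1}"
proof (rule measurable_restrict_space2)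
  note borel_measure_on_ident_measurable[OF assms, measurable]
  show "norm \<in> borel_measurable \<mu>" by measurable
qed (auto simp: space_borel_measure_on[OF assms])

lemma finite_measure_radial_part:
  assumes "borel_measure_on (ball 0 1) \<mu>" "finite_measure \<mu>"
  shows "finite_measure (radial_part \<mu>)"
proof -
  interpret D: finite_measure "distr \<mu> (restrict_space borel {0..<1}) norm"
    using assms by (intro finite_measure.finite_measure_distr measurable_norm_ball)
  show ?thesis
    unfolding radial_part_def
    by (rule finite_measureI) (simp add: ennreal_mult_eq_top_iff del: space_distr)
qed

lemma radial_extension_radial_part:
  assumes \<mu>: "borel_measure_on (ball 0 1) \<mu>" and fin: "finite_measure \<mu>" and rad: "radial \<mu>"
  shows "radial_extension (radial_part \<mu>) = \<mu>"
proof (rule measure_eqI)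
  show "sets (radial_extension (radial_part \<mu>)) = sets \<mu>"
    using \<mu> by (simp add: radial_extension_def borel_measure_on_def)
next
  fix Z assume "Z \<in> sets (radial_extension (radial_part \<mu>))"
  then have Z: "Z \<in> sets (restrict_space borel (ball 0 1))"
    by (simp add: radial_extension_def)
  then have Zb: "Z \<in> sets borel"
    by (auto simp: sets_restrict_space_iff)
  define c where "c w = emeasure circle_measure {s \<in> sphere 0 1. w * s \<in> Z}" for w
  \<comment> \<open>Measurability in the radius is what permits the change of variables along
    \<open>norm\<close> below.\<close>
  have c_meas: "(\<lambda>r. c (of_real r)) \<in> borel_measurable (restrict_space borel {0..<1})"
    unfolding c_def
    by (intro measurable_emeasure_circle_mult Zb measurable_restrict_space1) simp
  have "emeasure (radial_extension (radial_part \<mu>)) Z = (\<integral>\<^sup>+r. c (of_real r) \<partial>radial_part \<mu>)"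
    unfolding c_def by (rule emeasure_radial_extension_integral[OF borel_measure_on_radial_part Z])
  also have "\<dots> = ennreal (1 / (2 * pi)) * (\<integral>\<^sup>+z. c (of_real (norm z)) \<partial>\<mu>)"
    unfolding radial_part_def using c_meas
    by (simp add: nn_integral_scale_measure nn_integral_distr measurable_norm_ball[OF \<mu>])
  \<comment> \<open>Rotation invariance replaces the modulus of \<open>z\<close> by \<open>z\<close>
    itself; radiality of \<mu> then enters through the averaging identity.\<close>
  also have "(\<integral>\<^sup>+z. c (of_real (norm z)) \<partial>\<mu>) = ennreal (2 * pi) * emeasure \<mu> Z"
    unfolding c_def emeasure_circle_mult_norm[OF Zb] by (rule radial_average[OF \<mu> fin rad Z])
  also have "ennreal (1 / (2 * pi)) * (ennreal (2 * pi) * emeasure \<mu> Z) = emeasure \<mu> Z"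
    by (simp add: mult.assoc[symmetric] ennreal_mult[symmetric])
  finally show "emeasure (radial_extension (radial_part \<mu>)) Z = emeasure \<mu> Z" .
qed

theorem theorem2p4:
  fixes \<mu> :: "complex measure"
  assumes "borel_measure_on (ball 0 1) \<mu>"
    and "finite_measure \<mu>"
  shows "radial \<mu> \<longleftrightarrow>
    (\<exists>\<eta>::real measure. borel_measure_on {0..<1} \<eta> \<and> finite_measure \<eta> \<and> \<mu> = radial_extension \<eta>)"
proof
  assume "radial \<mu>"
  \<comment> \<open>The witness is \<open>radial_part \<mu>\<close>.\<close>
  then show "\<exists>\<eta>. borel_measure_on {0..<1} \<eta> \<and> finite_measure \<eta> \<and> \<mu> = radial_extension \<eta>"
    using assms borel_measure_on_radial_part finite_measure_radial_part
      radial_extension_radial_part by metis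
qed (auto simp: radial_radial_extension)

end
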